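(* Let $n\ge 1$ be an integer, let $f:(0,\infty)\to\mathbb{C}$ be a measurable function and let $z>0$. Provided that the integrals involved converge absolutely, the second iterate of the $\mathcal{L}_{2n}$-transform satisfies $$\mathcal{L}_{2n}\{\mathcal{L}_{2n}\{f(x);y\};z\}=\frac{1}{2n}\,\mathcal{P}_{2n}\{f(x);z\},$$ where the outer transform on the left is applied to the function $y\mapsto \mathcal{L}_{2n}\{f(x);y\}$ and evaluated at $z$.
   Context: For an integer $n\ge 1$, a function $f$ on $(0,\infty)$ and $y>0$, define $$\mathcal{L}_{2n}\{f(x);y\}=\int_0^\infty x^{2n-1}\exp(-y^{2n}x^{2n})f(x)\,dx,\qquad \mathcal{P}_{2n}\{f(x);y\}=\int_0^\infty\frac{x^{2n-1}f(x)}{x^{2n}+y^{2n}}\,dx.$$ In the notation $\mathcal{T}\{f(x);y\}$, the variable $x$ is the dummy variable of the function being transformed and $y$ is the point at which the transform is evaluated. *)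

theory Defs
  imports "HOL-Analysis.Analysis"
begin

(* Integrals over (0,infinity) are Lebesgue integrals, so set_integrable below means
   absolute convergence. Functions on (0,infinity) are total functions on the reals whose
   values outside (0,infinity) are irrelevant. *)

definition L2n_integrand :: "nat \<Rightarrow> (real \<Rightarrow> complex) \<Rightarrow> real \<Rightarrow> real \<Rightarrow> complex" where
  "L2n_integrand n f y x =
     complex_of_real (x ^ (2*n - 1) * exp (- (y ^ (2*n) * x ^ (2*n)))) * f x"

definition L2n :: "nat \<Rightarrow> (real \<Rightarrow> complex) \<Rightarrow> real \<Rightarrow> complex" where
  "L2n n f y = (LINT x:{0<..}|lebesgue. L2n_integrand n f y x)"

definition L2n_abs_conv :: "nat \<Rightarrow> (real \<Rightarrow> complex) \<Rightarrow> real \<Rightarrow> bool" where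
  "L2n_abs_conv n f y \<longleftrightarrow> set_integrable lebesgue {0<..} (L2n_integrand n f y)"

definition P2n_integrand :: "nat \<Rightarrow> (real \<Rightarrow> complex) \<Rightarrow> real \<Rightarrow> real \<Rightarrow> complex" where
  "P2n_integrand n f y x =
     complex_of_real (x ^ (2*n - 1)) * f x / complex_of_real (x ^ (2*n) + y ^ (2*n))"

definition P2n :: "nat \<Rightarrow> (real \<Rightarrow> complex) \<Rightarrow> real \<Rightarrow> complex" where
  "P2n n f y = (LINT x:{0<..}|lebesgue. P2n_integrand n f y x)"

definition P2n_abs_conv :: "nat \<Rightarrow> (real \<Rightarrow> complex) \<Rightarrow> real \<Rightarrow> bool" where
  "P2n_abs_conv n f y \<longleftrightarrow> set_integrable lebesgue {0<..} (P2n_integrand n f y)"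

end

theory Submission
  imports Defs
begin

text \<open>
  Fubini's theorem applied to
  \<open>g x * y ^ (2*n - 1) * exp (- ((x ^ (2*n) + z ^ (2*n)) * y ^ (2*n)))\<close> with
  \<open>g x = x ^ (2*n - 1) * f x\<close>: integrating in \<open>x\<close> first gives the iterated transform, and
  integrating in \<open>y\<close> first contributes the factor \<open>1 / (2*n * (x ^ (2*n) + z ^ (2*n)))\<close>. Since
  the kernel is nonnegative, the same computation for \<open>norm (g x)\<close> reduces the integrability
  hypothesis of Fubini's theorem to the absolute convergence of the \<open>P2n\<close> integral.
\<close>

text \<open>A countable cover by sets of finite measure serves the completion too, since both
  measures agree on \<open>sets M\<close>. This makes Fubini available for \<open>lebesgue\<close>,
  the completion of \<open>lborel\<close>.\<close>

lemma sigma_finite_measure_completion: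
  assumes "sigma_finite_measure M"
  shows "sigma_finite_measure (completion M)"
proof -
  obtain A where A: "countable A" "A \<subseteq> sets M" "\<Union>A = space M" "\<forall>a\<in>A. emeasure M a \<noteq> \<infinity>"
    using sigma_finite_measure.sigma_finite_countable[OF assms] by auto
  show ?thesis
  proof
    show "\<exists>A. countable A \<and> A \<subseteq> sets (completion M) \<and> \<Union>A = space (completion M) \<and>
        (\<forall>a\<in>A. emeasure (completion M) a \<noteq> \<infinity>)"
      using A by (intro exI[of _ A]) (auto simp: subset_eq)
  qed
qed

lemma sigma_finite_measure_lebesgue: "sigma_finite_measure lebesgue"
  by (intro sigma_finite_measure_completion sigma_finite_lborel)

text \<open>The function \<open>- exp (- (a * y ^ p)) / (real p * a)\<close> is an antiderivative;
  it rises from \<open>- 1 / (real p * a)\<close> at 0 to the limit 0 at infinity.\<close>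

lemma has_bochner_integral_power_exp_power:
  fixes a :: real
  assumes a: "a > 0" and p: "p > 0"
  shows "has_bochner_integral lebesgue
           (\<lambda>y. indicator {0<..} y * (y ^ (p - 1) * exp (- (a * y ^ p)))) (1 / (real p * a))"
proof (rule has_bochner_integral_nn_integral)
  let ?h = "\<lambda>y::real. y ^ (p - 1) * exp (- (a * y ^ p))"
  let ?H = "\<lambda>y::real. - exp (- (a * y ^ p)) / (real p * a)"
  have deriv: "DERIV ?H y :> ?h y" for y
    using a p by (auto intro!: derivative_eq_intros simp: field_simps)
  have "((\<lambda>y. - exp (- (a * y ^ p)) / (real p * a)) \<longlongrightarrow> - 0 / (real p * a)) at_top"
    using a p
    by (intro tendsto_intros filterlim_compose[OF exp_at_bot]
        filterlim_compose[OF filterlim_uminus_at_bot_at_top]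
        filterlim_tendsto_pos_mult_at_top[OF tendsto_const] filterlim_pow_at_top filterlim_ident) auto
  then have lim: "(?H \<longlongrightarrow> 0) at_top"
    by simp
  \<comment> \<open>The fundamental theorem is applied on the closed half-line, which adds only the
    null set \<open>{0}\<close>; for \<open>p = 1\<close> the two integrands really differ
    there.\<close>
  have "(\<integral>\<^sup>+y. ennreal (indicator {0<..} y * ?h y) \<partial>lebesgue) =
        (\<integral>\<^sup>+y. ennreal (?h y) * indicator {0..} y \<partial>lborel)"
    unfolding nn_integral_completion
    by (intro nn_integral_cong_AE eventually_mono[OF AE_lborel_singleton[of 0]])
      (auto simp: indicator_def)
  also have "\<dots> = ennreal (0 - ?H 0)"
    by (rule nn_integral_FTC_atLeast[OF _ deriv _ lim]) auto
  finally show "(\<integral>\<^sup>+y. ennreal (indicator {0<..} y * ?h y) \<partial>lebesgue) = ennreal (1 / (real p * a))"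
    using p by (simp add: zero_power)
  show "(\<lambda>y. indicator {0<..} y * ?h y) \<in> borel_measurable lebesgue"
    by (intro measurable_completion) simp
qed (use a in \<open>auto simp: indicator_def\<close>)

theorem lemma3:
  fixes n :: nat and f :: "real \<Rightarrow> complex" and z :: real
  assumes "n \<ge> 1"
    and "f \<in> borel_measurable (lebesgue_on {0<..})"
    and "z > 0"
    and "\<And>y. y > 0 \<Longrightarrow> L2n_abs_conv n f y"
    and "L2n_abs_conv n (\<lambda>y. L2n n f y) z"
    and "P2n_abs_conv n f z"
  shows "L2n n (\<lambda>y. L2n n f y) z = 1 / (2 * of_nat n) * P2n n f z"
proof -
  interpret pair_sigma_finite "lebesgue :: real measure" "lebesgue :: real measure"
    by (simp add: pair_sigma_finite_def sigma_finite_measure_lebesgue)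
  define a where "a x = x ^ (2*n) + z ^ (2*n)" for x :: real
  \<comment> \<open>The indicators inside \<open>k\<close> and \<open>g\<close> turn all integrals
    over \<open>{0<..}\<close> into integrals over the whole line, so that Fubini applies to the
    plain product measure.\<close>
  define k where "k x y = indicator {0<..} y * (y ^ (2*n - 1) * exp (- (a x * y ^ (2*n))))"
    for x y :: real
  define g where "g x = indicator {0<..} x *\<^sub>R (complex_of_real (x ^ (2*n - 1)) * f x)" for x
  \<comment> \<open>The exponent is even, so this holds for negative \<open>x\<close> as well, and
    \<open>k_int\<close> can be stated for every real \<open>x\<close>.\<close>
  have a_pos: "a x > 0" for x
    using assms(3) by (auto simp: a_def intro: add_nonneg_pos)
  have k_nonneg: "k x y \<ge> 0" for x y
    by (auto simp: k_def indicator_def)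
  have k_int: "has_bochner_integral lebesgue (k x) (1 / (2 * real n * a x))" for x
    using has_bochner_integral_power_exp_power[OF a_pos, of "2*n" x] assms(1)
    by (simp add: k_def[abs_def])
  have P_eq: "indicator {0<..} x *\<^sub>R P2n_integrand n f z x = g x / complex_of_real (a x)" for x
    by (simp add: g_def P2n_integrand_def a_def scaleR_conv_of_real)

  have id_borel: "(\<lambda>x. x) \<in> borel_measurable lebesgue"
    by (intro measurable_completion) simp
  have "(\<lambda>x. indicator {0<..} x *\<^sub>R f x) \<in> borel_measurable lebesgue"
    using assms(2) by (simp add: borel_measurable_restrict_space_iff)
  then have "(\<lambda>x. complex_of_real (x ^ (2*n - 1)) * (indicator {0<..} x *\<^sub>R f x))
      \<in> borel_measurable lebesgue"
    using id_borel by measurable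
  also have "(\<lambda>x. complex_of_real (x ^ (2*n - 1)) * (indicator {0<..} x *\<^sub>R f x)) = g"
    by (auto simp: g_def)
  finally have g_meas: "g \<in> borel_measurable lebesgue" .
  \<comment> \<open>Unlike \<open>g\<close>, the kernel is Borel; its measurability is pulled back
    along the identity map from the Lebesgue product to the Borel product.\<close>
  have "(\<lambda>p. k (fst p) (snd p)) \<in> borel_measurable (borel \<Otimes>\<^sub>M borel)"
    unfolding k_def a_def by measurable
  moreover have "(\<lambda>p. (fst p, snd p)) \<in> lebesgue \<Otimes>\<^sub>M lebesgue \<rightarrow>\<^sub>M borel \<Otimes>\<^sub>M borel"
    by (intro measurable_Pair measurable_compose[OF measurable_fst id_borel]
        measurable_compose[OF measurable_snd id_borel])
  ultimately have k_meas: "(\<lambda>p. k (fst p) (snd p)) \<in> borel_measurable (lebesgue \<Otimes>\<^sub>M lebesgue)"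
    by (auto dest: measurable_compose[rotated])
  have meas: "(\<lambda>(x, y). complex_of_real (k x y) * g x) \<in> borel_measurable (lebesgue \<Otimes>\<^sub>M lebesgue)"
    unfolding case_prod_beta
    by (intro borel_measurable_times measurable_compose[OF k_meas borel_measurable_of_real]
        measurable_compose[OF measurable_fst g_meas])

  have "(\<lambda>x. \<integral>y. norm (complex_of_real (k x y) * g x) \<partial>lebesgue) =
      (\<lambda>x. 1 / (2 * real n) * norm (g x / complex_of_real (a x)))"
    using k_int k_nonneg a_pos
    by (simp add: norm_mult norm_divide has_bochner_integral_iff less_imp_le fun_eq_iff)
  moreover have "integrable lebesgue (\<lambda>x. g x / complex_of_real (a x))"
    using assms(6) by (simp add: P2n_abs_conv_def set_integrable_def P_eq)
  \<comment> \<open>Besides the integrability in \<open>x\<close> of the inner norm integrals,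
    \<open>Fubini_integrable\<close> asks that the section in \<open>y\<close> be integrable for
    almost every \<open>x\<close>; \<open>k_int\<close> gives this for all \<open>x\<close>.\<close>
  ultimately have "integrable (lebesgue \<Otimes>\<^sub>M lebesgue) (\<lambda>(x, y). complex_of_real (k x y) * g x)"
    using meas k_int by (intro Fubini_integrable) (auto simp: has_bochner_integral_iff)
  then have Fubini: "(\<integral>y. (\<integral>x. complex_of_real (k x y) * g x \<partial>lebesgue) \<partial>lebesgue) =
      (\<integral>x. (\<integral>y. complex_of_real (k x y) * g x \<partial>lebesgue) \<partial>lebesgue)"
    by (rule Fubini_integral)

  \<comment> \<open>The exponential of the sum \<open>a x\<close> splits, and the part with
    \<open>z\<close> joins the factor \<open>c\<close>, which is constant in \<open>x\<close>. For
    nonpositive \<open>y\<close>, \<open>c\<close> vanishes and both sides are 0.\<close>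
  have "indicator {0<..} y *\<^sub>R L2n_integrand n (L2n n f) z y =
      (\<integral>x. complex_of_real (k x y) * g x \<partial>lebesgue)" for y
  proof -
    define c where
      "c = complex_of_real (indicator {0<..} y * (y ^ (2*n - 1) * exp (- (z ^ (2*n) * y ^ (2*n)))))"
    have "complex_of_real (k x y) * g x = c * (indicator {0<..} x *\<^sub>R L2n_integrand n f y x)" for x
    proof -
      have "exp (- (a x * y ^ (2*n))) = exp (- (z ^ (2*n) * y ^ (2*n))) * exp (- (y ^ (2*n) * x ^ (2*n)))"
        by (simp add: a_def exp_add[symmetric] algebra_simps)
      then show ?thesis
        by (simp add: k_def g_def c_def L2n_integrand_def scaleR_conv_of_real mult_ac)
    qed
    then have "(\<integral>x. complex_of_real (k x y) * g x \<partial>lebesgue) = c * L2n n f y"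
      by (simp only: L2n_def set_lebesgue_integral_def integral_mult_right_zero)
    then show ?thesis
      by (simp add: c_def L2n_integrand_def scaleR_conv_of_real mult_ac)
  qed
  then have "L2n n (L2n n f) z = (\<integral>y. (\<integral>x. complex_of_real (k x y) * g x \<partial>lebesgue) \<partial>lebesgue)"
    by (simp add: L2n_def[of n "L2n n f"] set_lebesgue_integral_def)
  also have "\<dots> = (\<integral>x. 1 / (2 * of_nat n) * (g x / complex_of_real (a x)) \<partial>lebesgue)"
    using k_int by (simp add: Fubini has_bochner_integral_iff)
  also have "\<dots> = 1 / (2 * of_nat n) * P2n n f z"
    by (simp only: P2n_def set_lebesgue_integral_def P_eq integral_mult_right_zero)
  finally show ?thesis .
qed

end
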